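(* Let $\varphi\colon R\to S$ be a ring morphism and $(\mathfrak a,M)$, with $\mathfrak a=\ker(\varphi)$ and $M=\varphi^{-1}(U(S))$, its corresponding pair in $\operatorname{Hom}(R)$. Then $\varphi$ is a local morphism if and only if $(\mathfrak a,M)$ is the least element of $\operatorname{Hom}(R,\mathfrak a)$ for some ideal $\mathfrak a\subseteq J(R)$ (that is, if and only if $\mathfrak a\subseteq J(R)$ and $(\mathfrak a,M)$ is the least element of $\operatorname{Hom}(R,\mathfrak a)$).
   Context: All rings are associative with identity $1\neq 0$ and ring morphisms send $1$ to $1$. $U(S)$ denotes the group of two-sided invertible elements of a ring $S$ and $J(R)$ the Jacobson radical of $R$. For a ring $R$, $\operatorname{Hom}(R)$ denotes the set of all pairs $(\ker(\varphi),\varphi^{-1}(U(S)))$ where $\varphi\colon R\to S$ is a ring morphism into an arbitrary ring $S$, partially ordered by $(\mathfrak a,M)\le(\mathfrak b,N)$ if and only if $\mathfrak a\subseteq\mathfrak b$ and $M\subseteq N$. For a proper two-sided ideal $\mathfrak a$ of $R$, $\operatorname{Hom}(R,\mathfrak a)$ is the subset of those pairs whose first component is $\mathfrak a$, with the induced partial order. A ring morphism $\varphi\colon R\to S$ is local if for every $r\in R$, $\varphi(r)$ invertible in $S$ implies $r$ invertible in $R$. *)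

theory Defs
  imports "HOL-Algebra.Algebra"
begin

locale nonzero_ring = ring R for R (structure) +
  assumes one_not_zero: "\<one> \<noteq> \<zero>"

definition unit_preimage ::
  "('a, 'm) ring_scheme \<Rightarrow> ('b, 'n) ring_scheme \<Rightarrow> ('a \<Rightarrow> 'b) \<Rightarrow> 'a set"
  where "unit_preimage R S \<phi> = {r \<in> carrier R. \<phi> r \<in> Units S}"

definition local_morphism ::
  "('a, 'm) ring_scheme \<Rightarrow> ('b, 'n) ring_scheme \<Rightarrow> ('a \<Rightarrow> 'b) \<Rightarrow> bool"
  where "local_morphism R S \<phi> \<longleftrightarrow>
    \<phi> \<in> ring_hom R S \<and> (\<forall>r \<in> carrier R. \<phi> r \<in> Units S \<longrightarrow> r \<in> Units R)"

text \<open>The locale \<^locale>\<open>ideal\<close> is about two-sided ideals, so left ideals have to be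
  introduced here.\<close>

locale left_ideal = additive_subgroup I R + ring R for I and R (structure) +
  assumes left_closed: "\<lbrakk>a \<in> I; x \<in> carrier R\<rbrakk> \<Longrightarrow> x \<otimes> a \<in> I"

definition maximal_left_ideal :: "'a set \<Rightarrow> ('a, 'm) ring_scheme \<Rightarrow> bool"
  where "maximal_left_ideal I R \<longleftrightarrow>
    left_ideal I R \<and> I \<noteq> carrier R \<and>
    (\<forall>J. left_ideal J R \<and> I \<subseteq> J \<longrightarrow> J = I \<or> J = carrier R)"

definition jacobson_radical :: "('a, 'm) ring_scheme \<Rightarrow> 'a set"
  where "jacobson_radical R = {r \<in> carrier R. \<forall>I. maximal_left_ideal I R \<longrightarrow> r \<in> I}"

text \<open>The codomain is meant to range over all rings, but a definition cannot quantify
  over types. It is enough to let it range over the rings with carrier in the type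
  \<^typ>\<open>'a list\<close>: a morphism may be corestricted to the subring generated by its image
  under the ring operations and inverses of units of the codomain. This changes neither
  the kernel nor the set of elements that become invertible, and the elements of that
  subring are named by finite expressions over \<^typ>\<open>'a\<close>. Lemma \<open>hom_pairs_universal\<close> below
  proves that no pair is lost, whatever the type of the codomain.\<close>

definition hom_pairs :: "('a, 'm) ring_scheme \<Rightarrow> ('a set \<times> 'a set) set"
  where "hom_pairs R =
    {(a_kernel R S \<phi>, unit_preimage R S \<phi>) | (S :: 'a list ring) \<phi>.
       nonzero_ring S \<and> \<phi> \<in> ring_hom R S}"

definition hom_poset :: "('a, 'm) ring_scheme \<Rightarrow> ('a set \<times> 'a set) gorder"
  where "hom_poset R =
    \<lparr>carrier = hom_pairs R, eq = (=), le = (\<lambda>(a, M) (b, N). a \<subseteq> b \<and> M \<subseteq> N)\<rparr>"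

definition hom_pairs_over :: "('a, 'm) ring_scheme \<Rightarrow> 'a set \<Rightarrow> ('a set \<times> 'a set) set"
  where "hom_pairs_over R a = {p \<in> hom_pairs R. fst p = a}"

datatype 'a rexp = Gen 'a | Neg "'a rexp" | Add "'a rexp" "'a rexp"
  | Mul "'a rexp" "'a rexp" | Inv "'a rexp"

primrec reval ::
  "('a, 'm) ring_scheme \<Rightarrow> ('b, 'n) ring_scheme \<Rightarrow> ('a \<Rightarrow> 'b) \<Rightarrow> 'a rexp \<Rightarrow> 'b" where
  "reval R S \<phi> (Gen a) = (if a \<in> carrier R then \<phi> a else \<zero>\<^bsub>S\<^esub>)"
| "reval R S \<phi> (Neg e) = \<ominus>\<^bsub>S\<^esub> reval R S \<phi> e"
| "reval R S \<phi> (Add e f) = reval R S \<phi> e \<oplus>\<^bsub>S\<^esub> reval R S \<phi> f"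
| "reval R S \<phi> (Mul e f) = reval R S \<phi> e \<otimes>\<^bsub>S\<^esub> reval R S \<phi> f"
| "reval R S \<phi> (Inv e) =
     (if reval R S \<phi> e \<in> Units S then inv\<^bsub>S\<^esub> reval R S \<phi> e else \<zero>\<^bsub>S\<^esub>)"

text \<open>A prefix code over two distinct letters \<open>z\<close>, \<open>u\<close>.\<close>

primrec rcode :: "'a \<Rightarrow> 'a \<Rightarrow> 'a rexp \<Rightarrow> 'a list" where
  "rcode z u (Gen a) = [z, z, z, a]"
| "rcode z u (Neg e) = [z, z, u] @ rcode z u e"
| "rcode z u (Add e f) = [z, u, z] @ rcode z u e @ rcode z u f"
| "rcode z u (Mul e f) = [z, u, u] @ rcode z u e @ rcode z u f"
| "rcode z u (Inv e) = [u, z, z] @ rcode z u e"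

lemma rcode_prefix:
  assumes "z \<noteq> u"
  shows "rcode z u e @ xs = rcode z u e' @ ys \<Longrightarrow> e = e' \<and> xs = ys"
proof (induction e arbitrary: e' xs ys)
  case (Gen a) then show ?case using assms by (cases e') auto
next
  case (Neg e)
  show ?case
  proof (cases e')
    case (Neg f) then show ?thesis using Neg.prems Neg.IH[of xs f ys] by auto
  qed (use Neg.prems assms in auto)
next
  case (Inv e)
  show ?case
  proof (cases e')
    case (Inv f) then show ?thesis using Inv.prems Inv.IH[of xs f ys] by auto
  qed (use Inv.prems assms in auto)
next
  case (Add e f)
  show ?case
  proof (cases e')
    case (Add g h) then show ?thesis
      using Add.prems Add.IH(1)[of "rcode z u f @ xs" g "rcode z u h @ ys"]
        Add.IH(2)[of xs h ys] by auto
  qed (use Add.prems assms in auto)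
next
  case (Mul e f)
  show ?case
  proof (cases e')
    case (Mul g h) then show ?thesis
      using Mul.prems Mul.IH(1)[of "rcode z u f @ xs" g "rcode z u h @ ys"]
        Mul.IH(2)[of xs h ys] by auto
  qed (use Mul.prems assms in auto)
qed

lemma inj_rcode: "z \<noteq> u \<Longrightarrow> inj (rcode z u)"
  by (rule injI) (metis append_Nil2 rcode_prefix)

lemma ring_hom_maps_Units:
  assumes "monoid T" "h \<in> ring_hom T T'" "x \<in> Units T"
  shows "h x \<in> Units T'"
proof -
  interpret monoid T by fact
  have x: "x \<in> carrier T" "inv\<^bsub>T\<^esub> x \<in> carrier T" using assms(3) by auto
  have "h (inv\<^bsub>T\<^esub> x) \<otimes>\<^bsub>T'\<^esub> h x = \<one>\<^bsub>T'\<^esub>" "h x \<otimes>\<^bsub>T'\<^esub> h (inv\<^bsub>T\<^esub> x) = \<one>\<^bsub>T'\<^esub>"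
    using ring_hom_mult[OF assms(2)] ring_hom_one[OF assms(2)] x assms(3)
    by (metis Units_l_inv, metis Units_r_inv)
  moreover have "h x \<in> carrier T'" "h (inv\<^bsub>T\<^esub> x) \<in> carrier T'"
    using x ring_hom_closed[OF assms(2)] by auto
  ultimately show ?thesis unfolding Units_def by blast
qed

lemma hom_pairs_universal:
  fixes R :: "('a, 'm) ring_scheme" and S :: "('b, 'n) ring_scheme"
  assumes R: "nonzero_ring R" and S: "nonzero_ring S" and hom: "\<phi> \<in> ring_hom R S"
  shows "(a_kernel R S \<phi>, unit_preimage R S \<phi>) \<in> hom_pairs R"
proof -
  interpret R: nonzero_ring R by fact
  interpret S: nonzero_ring S by fact
  define ev where "ev = reval R S \<phi>"
  define H where "H = range ev"
  define T where "T = S\<lparr>carrier := H\<rparr>"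
  have ev_closed: "ev e \<in> carrier S" for e
    unfolding ev_def by (induction e) (auto intro: ring_hom_closed[OF hom])
  have gen: "\<phi> a \<in> H" if "a \<in> carrier R" for a
    using that rangeI[of ev "Gen a"] by (simp add: H_def ev_def)
  have sub: "subring H S"
  proof (rule S.subringI)
    show "H \<subseteq> carrier S" using ev_closed by (auto simp: H_def)
    show "\<one>\<^bsub>S\<^esub> \<in> H" using gen[OF R.one_closed] ring_hom_one[OF hom] by simp
    show "\<ominus>\<^bsub>S\<^esub> h \<in> H" if "h \<in> H" for h
    proof -
      from that obtain e where "h = ev e" by (auto simp: H_def)
      then have "\<ominus>\<^bsub>S\<^esub> h = ev (Neg e)" by (simp add: ev_def)
      then show ?thesis by (simp add: H_def)
    qed
    fix h k assume "h \<in> H" "k \<in> H"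
    then obtain e f where "h = ev e" "k = ev f" by (auto simp: H_def)
    then have "h \<otimes>\<^bsub>S\<^esub> k = ev (Mul e f)" "h \<oplus>\<^bsub>S\<^esub> k = ev (Add e f)"
      by (simp_all add: ev_def)
    then show "h \<otimes>\<^bsub>S\<^esub> k \<in> H" "h \<oplus>\<^bsub>S\<^esub> k \<in> H" by (simp_all add: H_def)
  qed
  have ringT: "ring T" unfolding T_def by (rule S.subring_is_ring[OF sub])
  then interpret T: ring T .
  have Hcar: "H \<subseteq> carrier S" by (rule subringE(1)[OF sub])
  have UnitsT: "x \<in> Units T \<longleftrightarrow> x \<in> Units S" if x: "x \<in> H" for x
  proof
    assume "x \<in> Units T"
    then show "x \<in> Units S" using Hcar by (auto simp: Units_def T_def)
  next
    assume u: "x \<in> Units S"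
    obtain e where e: "x = ev e" using x by (auto simp: H_def)
    then have "inv\<^bsub>S\<^esub> x = ev (Inv e)" using u by (simp add: ev_def)
    then have "inv\<^bsub>S\<^esub> x \<in> H" by (simp add: H_def)
    moreover have "inv\<^bsub>S\<^esub> x \<otimes>\<^bsub>S\<^esub> x = \<one>\<^bsub>S\<^esub>" "x \<otimes>\<^bsub>S\<^esub> inv\<^bsub>S\<^esub> x = \<one>\<^bsub>S\<^esub>"
      using S.Units_l_inv[OF u] S.Units_r_inv[OF u] by auto
    ultimately show "x \<in> Units T"
      using x unfolding Units_def T_def by auto
  qed
  define g where "g = rcode \<zero>\<^bsub>R\<^esub> \<one>\<^bsub>R\<^esub> \<circ> inv_into UNIV ev"
  have injg: "inj_on g (carrier T)"
    unfolding g_def T_def H_def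
    using inj_rcode[of "\<zero>\<^bsub>R\<^esub>" "\<one>\<^bsub>R\<^esub>"] R.one_not_zero inj_on_inv_into[of "range ev" ev UNIV]
    by (auto intro!: comp_inj_on elim: inj_on_subset)
  define W where "W = image_ring g T"
  have iso: "g \<in> ring_iso T W"
    unfolding W_def by (rule inj_imp_image_ring_iso[OF injg])
  have ghom: "g \<in> ring_hom T W" using iso by (simp add: ring_iso_def)
  have ringW: "ring W" unfolding W_def by (rule T.inj_imp_image_ring_is_ring[OF injg])
  then interpret W: ring W .
  have g_zero: "g \<zero>\<^bsub>S\<^esub> = \<zero>\<^bsub>W\<^esub>" by (simp add: W_def image_ring_zero T_def)
  have g_one: "g \<one>\<^bsub>S\<^esub> = \<one>\<^bsub>W\<^esub>" by (simp add: W_def image_ring_one T_def)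
  have zH: "\<zero>\<^bsub>S\<^esub> \<in> H" "\<one>\<^bsub>S\<^esub> \<in> H" using T.zero_closed T.one_closed by (simp_all add: T_def)
  have carT: "carrier T = H" by (simp add: T_def)
  have "\<one>\<^bsub>W\<^esub> \<noteq> \<zero>\<^bsub>W\<^esub>"
    using inj_onD[OF injg, of "\<one>\<^bsub>S\<^esub>" "\<zero>\<^bsub>S\<^esub>"] zH S.one_not_zero g_zero g_one carT by auto
  then have nzW: "nonzero_ring W"
    using ringW by (simp add: nonzero_ring_def nonzero_ring_axioms_def)
  have homT: "\<phi> \<in> ring_hom R T"
    using hom gen by (auto simp: ring_hom_def T_def)
  have homW: "g \<circ> \<phi> \<in> ring_hom R W" by (rule ring_hom_trans[OF homT ghom])
  have "a_kernel R W (g \<circ> \<phi>) = a_kernel R S \<phi>"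
    using inj_onD[OF injg] gen zH g_zero carT by (auto simp: a_kernel_def')
  moreover have "unit_preimage R W (g \<circ> \<phi>) = unit_preimage R S \<phi>"
  proof -
    have "g y \<in> Units W \<longleftrightarrow> y \<in> Units S" if y: "y \<in> H" for y
    proof -
      have "y \<in> Units T" if u: "g y \<in> Units W"
      proof -
        have inv: "inv_into (carrier T) g \<in> ring_hom W T"
          using ring_iso_set_sym[OF ringT iso] by (simp add: ring_iso_def)
        from ring_hom_maps_Units[OF W.monoid_axioms inv u] show ?thesis
          using y injg carT by simp
      qed
      then show ?thesis
        using UnitsT[OF y] ring_hom_maps_Units[OF T.monoid_axioms ghom] by blast
    qed
    then show ?thesis using gen by (auto simp: unit_preimage_def)
  qed
  ultimately show ?thesis
    unfolding hom_pairs_def using nzW homW by force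
qed

end

theory Submission
  imports Defs
begin

text \<open>Write \<open>\<aa>\<close> for the kernel of \<open>\<phi>\<close>. Every morphism inverts the units of \<open>R\<close>, so the
  second component of a pair is never smaller than the group of units of \<open>R\<close>, and \<open>\<phi>\<close> is
  local exactly when its pair attains this lower bound. A local \<open>\<phi>\<close> therefore gives the
  least pair over \<open>\<aa>\<close>; it also has kernel inside the Jacobson radical, because for
  \<open>r \<in> \<aa>\<close> each \<open>1 + xr\<close> is sent to \<open>1\<close> and hence is a unit, and this
  property characterizes the radical (\<open>mem_jacobson_radical_iff\<close>).

  Conversely, minimality of the pair of \<open>\<phi>\<close> only has to be compared with the pair of the
  projection \<open>R \<rightarrow> R/\<aa>\<close>: an element inverted by \<open>\<phi>\<close> is then already invertible modulo
  \<open>\<aa>\<close>. If \<open>\<aa>\<close> lies in the Jacobson radical, units lift along this projection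
  (\<open>Units_lift_mod_jacobson\<close>), so the element was a unit of \<open>R\<close>.\<close>

section \<open>Left ideals and the Jacobson radical\<close>

context ring
begin

lemma left_idealI:
  assumes "I \<subseteq> carrier R" "\<zero> \<in> I"
    and add: "\<And>a b. \<lbrakk>a \<in> I; b \<in> I\<rbrakk> \<Longrightarrow> a \<oplus> b \<in> I"
    and mult: "\<And>a x. \<lbrakk>a \<in> I; x \<in> carrier R\<rbrakk> \<Longrightarrow> x \<otimes> a \<in> I"
  shows "left_ideal I R"
proof -
  have minus: "\<ominus> a \<in> I" if "a \<in> I" for a
    using mult[OF that, of "\<ominus> \<one>"] that assms(1) by (auto simp: l_minus)
  have "subgroup I (add_monoid R)"
    by (rule add.subgroupI) (use assms minus in \<open>auto simp: a_inv_def\<close>)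
  then show ?thesis
    by (intro left_ideal.intro additive_subgroup.intro left_ideal_axioms.intro
        ring_axioms mult)
qed

lemma left_ideal_with_one:
  assumes "left_ideal I R" "\<one> \<in> I"
  shows "I = carrier R"
proof -
  interpret I: left_ideal I R by fact
  show ?thesis
    using I.left_closed[OF assms(2)] I.a_subset by force
qed

text \<open>The left ideal \<open>I + Rr\<close>; for \<open>I = 0\<close> it is the principal left ideal \<open>Rr\<close>.\<close>

lemma left_ideal_adjoin:
  assumes "left_ideal I R" "r \<in> carrier R"
  shows "left_ideal {a \<oplus> x \<otimes> r | a x. a \<in> I \<and> x \<in> carrier R} R"
    (is "left_ideal ?K R")
proof (rule left_idealI)
  interpret I: left_ideal I R by fact
  note r = assms(2)
  note Icar = I.a_Hcarr
  show "?K \<subseteq> carrier R" using r Icar by auto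
  show "\<zero> \<in> ?K"
    using r I.zero_closed by (intro CollectI exI[of _ \<zero>]) auto
  show "k \<oplus> l \<in> ?K" if "k \<in> ?K" "l \<in> ?K" for k l
  proof -
    from that obtain a x b y where *: "k = a \<oplus> x \<otimes> r" "l = b \<oplus> y \<otimes> r"
      "a \<in> I" "b \<in> I" "x \<in> carrier R" "y \<in> carrier R" by blast
    then have "k \<oplus> l = (a \<oplus> b) \<oplus> (x \<oplus> y) \<otimes> r"
      using r Icar by (simp add: l_distr a_ac)
    then show ?thesis using * I.a_closed by blast
  qed
  show "y \<otimes> k \<in> ?K" if "k \<in> ?K" "y \<in> carrier R" for k y
  proof -
    from that obtain a x where *: "k = a \<oplus> x \<otimes> r" "a \<in> I" "x \<in> carrier R" by blast
    then have "y \<otimes> k = y \<otimes> a \<oplus> (y \<otimes> x) \<otimes> r"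
      using r Icar that by (simp add: r_distr m_assoc)
    then show ?thesis using * that I.left_closed by blast
  qed
qed

text \<open>Properness means avoiding \<open>\<one>\<close>, which passes to unions of chains, so Zorn's lemma
  applies.\<close>

lemma maximal_left_ideal_exists:
  assumes I: "left_ideal I R" and proper: "\<one> \<notin> I"
  obtains K where "maximal_left_ideal K R" "I \<subseteq> K"
proof -
  let ?A = "{K. left_ideal K R \<and> I \<subseteq> K \<and> \<one> \<notin> K}"
  have "\<exists>K\<in>?A. \<forall>L\<in>?A. K \<subseteq> L \<longrightarrow> L = K"
  proof (rule subset_Zorn_nonempty)
    show "?A \<noteq> {}" using I proper by blast
    fix C assume ne: "C \<noteq> {}" and C: "subset.chain ?A C"
    have mem: "left_ideal K R" "I \<subseteq> K" "\<one> \<notin> K" if "K \<in> C" for K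
      using C that by (auto simp: subset_chain_def)
    have "left_ideal (\<Union>C) R"
    proof (rule left_idealI)
      show "\<Union>C \<subseteq> carrier R"
      proof (rule Union_least)
        fix K assume "K \<in> C"
        then interpret left_ideal K R by (rule mem)
        show "K \<subseteq> carrier R" by (rule a_subset)
      qed
      obtain K where K: "K \<in> C" using ne by blast
      interpret K: left_ideal K R by (rule mem(1)[OF K])
      show "\<zero> \<in> \<Union>C" by (rule UnionI[OF K K.zero_closed])
      show "x \<otimes> a \<in> \<Union>C" if "a \<in> \<Union>C" "x \<in> carrier R" for a x
      proof -
        from that obtain L where L: "L \<in> C" "a \<in> L" by blast
        interpret L: left_ideal L R by (rule mem(1)[OF L(1)])
        show ?thesis by (rule UnionI[OF L(1) L.left_closed[OF L(2) that(2)]])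
      qed
      show "a \<oplus> b \<in> \<Union>C" if ab: "a \<in> \<Union>C" "b \<in> \<Union>C" for a b
      proof -
        from ab obtain K L where KL: "K \<in> C" "L \<in> C" "a \<in> K" "b \<in> L" by blast
        then have "K \<subseteq> L \<or> L \<subseteq> K" using C by (auto simp: subset_chain_def)
        then obtain N where N: "N \<in> C" "a \<in> N" "b \<in> N" using KL by blast
        interpret N: left_ideal N R by (rule mem(1)[OF N(1)])
        show ?thesis by (rule UnionI[OF N(1) N.a_closed[OF N(2,3)]])
      qed
    qed
    then show "\<Union>C \<in> ?A" using mem ne by blast
  qed
  then obtain K where "K \<in> ?A" and max: "\<forall>L\<in>?A. K \<subseteq> L \<longrightarrow> L = K" ..
  then have K: "left_ideal K R" "I \<subseteq> K" "\<one> \<notin> K" by simp_all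
  have maxK: "L = K \<or> L = carrier R" if L: "left_ideal L R" "K \<subseteq> L" for L
  proof (cases "\<one> \<in> L")
    case True
    then show ?thesis using left_ideal_with_one[OF L(1)] by simp
  next
    case False
    then have "L \<in> ?A" using L K(2) by simp
    then show ?thesis using max L(2) by simp
  qed
  have "maximal_left_ideal K R"
    unfolding maximal_left_ideal_def
    using K(1,3) one_closed by (intro conjI allI impI) (auto dest: maxK)
  then show thesis using K(2) by (rule that)
qed

text \<open>An element \<open>y\<close> without left inverse generates a proper left ideal \<open>Ry\<close>, and a maximal
  left ideal above it cannot contain \<open>y - 1\<close>.\<close>

lemma one_plus_jacobson_left_inverse:
  assumes "r \<in> jacobson_radical R"
  shows "\<exists>u\<in>carrier R. u \<otimes> (\<one> \<oplus> r) = \<one>"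
proof (rule ccontr)
  assume no: "\<not> ?thesis"
  have r: "r \<in> carrier R" using assms by (simp add: jacobson_radical_def)
  define y where "y = \<one> \<oplus> r"
  have y: "y \<in> carrier R" using r by (simp add: y_def)
  have zero_ideal: "left_ideal {\<zero>} R" by (rule left_idealI) auto
  let ?P = "{a \<oplus> x \<otimes> y | a x. a \<in> {\<zero>} \<and> x \<in> carrier R}"
  have "\<one> \<notin> ?P" using no y by (auto simp: y_def)
  then obtain K where K: "maximal_left_ideal K R" "?P \<subseteq> K"
    using maximal_left_ideal_exists[OF left_ideal_adjoin[OF zero_ideal y]] by blast
  interpret K: left_ideal K R using K(1) by (simp add: maximal_left_ideal_def)
  have "y \<in> ?P" using y by (intro CollectI exI[of _ \<zero>] exI[of _ \<one>]) auto
  then have "y \<in> K" using K(2) by blast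
  moreover have "r \<in> K" using assms K(1) by (simp add: jacobson_radical_def)
  then have "\<ominus> r \<in> K" by (rule K.a_inv_closed)
  ultimately have "y \<oplus> \<ominus> r \<in> K" by (rule K.a_closed)
  also have "y \<oplus> \<ominus> r = \<one>" using r by (simp add: y_def a_assoc r_neg)
  finally show False
    using left_ideal_with_one[OF K.left_ideal_axioms] K(1)
    by (simp add: maximal_left_ideal_def)
qed

lemma jacobson_left_closed:
  assumes "r \<in> jacobson_radical R" "x \<in> carrier R"
  shows "x \<otimes> r \<in> jacobson_radical R"
  unfolding jacobson_radical_def
proof (intro CollectI conjI allI impI)
  show "x \<otimes> r \<in> carrier R" using assms by (simp add: jacobson_radical_def)
  fix I assume I: "maximal_left_ideal I R"
  then have "r \<in> I" using assms(1) by (simp add: jacobson_radical_def)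
  then show "x \<otimes> r \<in> I"
    using I assms(2) by (intro left_ideal.left_closed) (simp_all add: maximal_left_ideal_def)
qed

lemma eq_one_plus_minus_mult:
  assumes "a \<in> carrier R" "x \<in> carrier R" "r \<in> carrier R" "a \<oplus> x \<otimes> r = \<one>"
  shows "a = \<one> \<oplus> (\<ominus> x) \<otimes> r"
proof -
  have "\<one> \<oplus> (\<ominus> x) \<otimes> r = (a \<oplus> x \<otimes> r) \<oplus> \<ominus> (x \<otimes> r)"
    using assms by (simp add: l_minus)
  also have "\<dots> = a" using assms(1-3) by (simp add: a_assoc r_neg)
  finally show ?thesis by simp
qed

text \<open>A left inverse \<open>u\<close> of \<open>1 + r\<close> equals \<open>1 - ur\<close>, which again has a left inverse. So
  \<open>u\<close> is invertible on both sides, and with it \<open>1 + r\<close>.\<close>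

lemma one_plus_jacobson_unit:
  assumes "r \<in> jacobson_radical R"
  shows "\<one> \<oplus> r \<in> Units R"
proof -
  have r: "r \<in> carrier R" using assms by (simp add: jacobson_radical_def)
  obtain u where u: "u \<in> carrier R" "u \<otimes> (\<one> \<oplus> r) = \<one>"
    using one_plus_jacobson_left_inverse[OF assms] by blast
  have "u \<oplus> u \<otimes> r = \<one>" using u r by (simp add: r_distr)
  then have "u = \<one> \<oplus> (\<ominus> u) \<otimes> r" by (rule eq_one_plus_minus_mult[OF u(1,1) r])
  moreover have "(\<ominus> u) \<otimes> r \<in> jacobson_radical R"
    using jacobson_left_closed[OF assms] u(1) by simp
  ultimately obtain v where v: "v \<in> carrier R" "v \<otimes> u = \<one>"
    using one_plus_jacobson_left_inverse[of "(\<ominus> u) \<otimes> r"] by auto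
  have "v = \<one> \<oplus> r"
    using inv_unique[OF v(2) u(2)] u(1) v(1) r by simp
  then have "(\<one> \<oplus> r) \<otimes> u = \<one>" using v(2) by simp
  then show ?thesis using u r by (auto simp: Units_def)
qed

text \<open>The implication from right to left: if a maximal left ideal \<open>I\<close> misses \<open>r\<close>, then
  \<open>I + Rr = R\<close>, so some \<open>1 - xr\<close> lies in \<open>I\<close> and is not a unit.\<close>

lemma mem_jacobson_radical_iff:
  "r \<in> jacobson_radical R \<longleftrightarrow>
    r \<in> carrier R \<and> (\<forall>x\<in>carrier R. \<one> \<oplus> x \<otimes> r \<in> Units R)"
proof safe
  assume "r \<in> jacobson_radical R"
  then show "r \<in> carrier R" and "\<And>x. x \<in> carrier R \<Longrightarrow> \<one> \<oplus> x \<otimes> r \<in> Units R"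
    using one_plus_jacobson_unit jacobson_left_closed
    by (auto simp: jacobson_radical_def)
next
  assume r: "r \<in> carrier R" and unit: "\<forall>x\<in>carrier R. \<one> \<oplus> x \<otimes> r \<in> Units R"
  have "r \<in> I" if I: "maximal_left_ideal I R" for I
  proof (rule ccontr)
    assume "r \<notin> I"
    interpret I: left_ideal I R using I by (simp add: maximal_left_ideal_def)
    let ?K = "{a \<oplus> x \<otimes> r | a x. a \<in> I \<and> x \<in> carrier R}"
    have "I \<subseteq> ?K"
    proof
      fix a assume "a \<in> I"
      then show "a \<in> ?K"
        using r I.a_Hcarr by (intro CollectI exI[of _ a] exI[of _ \<zero>]) auto
    qed
    moreover have "r \<in> ?K"
      using r I.zero_closed by (intro CollectI exI[of _ \<zero>] exI[of _ \<one>]) auto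
    ultimately have "?K = carrier R"
      using I left_ideal_adjoin[OF I.left_ideal_axioms r] \<open>r \<notin> I\<close>
      unfolding maximal_left_ideal_def by blast
    then have "\<one> \<in> ?K" using one_closed by simp
    then obtain a x where a: "a \<in> I" and x: "x \<in> carrier R" and "a \<oplus> x \<otimes> r = \<one>"
      by auto
    then have "a = \<one> \<oplus> (\<ominus> x) \<otimes> r"
      using eq_one_plus_minus_mult[OF I.a_Hcarr[OF a] x r] by simp
    then have "a \<in> Units R" using unit x by simp
    then have "\<one> \<in> I" using I.left_closed[OF a, of "inv a"] by simp
    then show False
      using left_ideal_with_one[OF I.left_ideal_axioms] I
      by (simp add: maximal_left_ideal_def)
  qed
  then show "r \<in> jacobson_radical R" using r by (simp add: jacobson_radical_def)
qed

section \<open>Lifting units from a quotient\<close>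

lemma Units_of_both_products:
  assumes r: "r \<in> carrier R" and s: "s \<in> carrier R"
    and rs: "r \<otimes> s \<in> Units R" and sr: "s \<otimes> r \<in> Units R"
  shows "r \<in> Units R"
proof -
  let ?p = "s \<otimes> inv (r \<otimes> s)" and ?q = "inv (s \<otimes> r) \<otimes> s"
  have p: "?p \<in> carrier R" "r \<otimes> ?p = \<one>"
    using r s rs Units_r_inv[OF rs] by (simp_all add: m_assoc[symmetric])
  have q: "?q \<in> carrier R" "?q \<otimes> r = \<one>"
    using r s sr Units_l_inv[OF sr] by (simp_all add: m_assoc)
  have "?q = ?p" using inv_unique[OF q(2) p(2) r q(1) p(1)] .
  then show ?thesis using r p q by (auto simp: Units_def)
qed

text \<open>If \<open>s\<close> represents the inverse of \<open>r\<close> modulo \<open>\<aa>\<close>, then \<open>rs\<close> and \<open>sr\<close> both lie in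
  \<open>1 + \<aa>\<close>, hence are units of \<open>R\<close>.\<close>

lemma Units_lift_mod_jacobson:
  assumes "ideal \<aa> R" and J: "\<aa> \<subseteq> jacobson_radical R"
    and r: "r \<in> carrier R" and unit: "\<aa> +> r \<in> Units (R Quot \<aa>)"
  shows "r \<in> Units R"
proof -
  interpret ideal \<aa> R by fact
  have lift: "x \<in> Units R" if "x \<in> carrier R" "\<aa> +> x = \<aa> +> \<one>" for x
  proof -
    have "x \<in> \<aa> +> \<one>" using that a_rcos_self by metis
    then obtain a where a: "a \<in> \<aa>" "x = a \<oplus> \<one>"
      by (auto simp: a_r_coset_def')
    then have "x = \<one> \<oplus> a" using a_Hcarr by (simp add: a_comm)
    then show ?thesis using one_plus_jacobson_unit J a(1) by blast
  qed
  obtain s where s: "s \<in> carrier R"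
    and "(\<aa> +> s) \<otimes>\<^bsub>R Quot \<aa>\<^esub> (\<aa> +> r) = \<one>\<^bsub>R Quot \<aa>\<^esub>"
    and "(\<aa> +> r) \<otimes>\<^bsub>R Quot \<aa>\<^esub> (\<aa> +> s) = \<one>\<^bsub>R Quot \<aa>\<^esub>"
    using unit by (auto simp: Units_def FactRing_def A_RCOSETS_def')
  then have "\<aa> +> (s \<otimes> r) = \<aa> +> \<one>" "\<aa> +> (r \<otimes> s) = \<aa> +> \<one>"
    using ring_hom_mult[OF rcos_ring_hom] ring_hom_one[OF rcos_ring_hom] r s by auto
  then show ?thesis
    using r s by (intro Units_of_both_products[OF r s] lift) simp_all
qed

end

section \<open>Pairs over a fixed ideal\<close>

text \<open>The pair of the canonical projection, which serves as the test object for
  minimality over \<open>\<aa>\<close>.\<close>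

lemma quotient_pair_in_hom_pairs_over:
  fixes R (structure)
  assumes R: "nonzero_ring R" and id: "ideal \<aa> R" and proper: "\<aa> \<noteq> carrier R"
  shows "(\<aa>, unit_preimage R (R Quot \<aa>) ((+>) \<aa>)) \<in> hom_pairs_over R \<aa>"
proof -
  interpret nonzero_ring R by fact
  interpret ideal \<aa> R by fact
  have ker_iff: "\<aa> +> x = \<aa> \<longleftrightarrow> x \<in> \<aa>" if "x \<in> carrier R" for x
    using that a_rcos_self a_rcos_const by metis
  have "\<one> \<notin> \<aa>" using one_imp_carrier proper by blast
  then have "\<one>\<^bsub>R Quot \<aa>\<^esub> \<noteq> \<zero>\<^bsub>R Quot \<aa>\<^esub>"
    using ker_iff[OF one_closed] by (simp add: FactRing_def)
  then have "nonzero_ring (R Quot \<aa>)"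
    by (intro nonzero_ring.intro nonzero_ring_axioms.intro quotient_is_ring)
  moreover have "a_kernel R (R Quot \<aa>) ((+>) \<aa>) = \<aa>"
  proof -
    have "a_kernel R (R Quot \<aa>) ((+>) \<aa>) = {x \<in> carrier R. x \<in> \<aa>}"
      unfolding a_kernel_def' using ker_iff by (intro Collect_cong conj_cong)
        (simp_all add: FactRing_def)
    then show ?thesis using a_subset by blast
  qed
  ultimately show ?thesis
    using hom_pairs_universal[OF R _ rcos_ring_hom] by (simp add: hom_pairs_over_def)
qed

lemma Units_subset_hom_pairs_over:
  fixes R :: "('a, 'm) ring_scheme"
  assumes "nonzero_ring R" "(\<aa>, N) \<in> hom_pairs_over R \<aa>"
  shows "Units R \<subseteq> N"
proof -
  interpret nonzero_ring R by fact
  obtain S :: "'a list ring" and \<phi> where "\<phi> \<in> ring_hom R S" "N = unit_preimage R S \<phi>"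
    using assms(2) by (auto simp: hom_pairs_over_def hom_pairs_def)
  then show ?thesis
    using ring_hom_maps_Units[OF monoid_axioms] Units_closed
    unfolding unit_preimage_def by blast
qed

lemma least_hom_pairs_over_iff:
  "least (hom_poset R) (\<aa>, M) (hom_pairs_over R \<aa>) \<longleftrightarrow>
    (\<aa>, M) \<in> hom_pairs_over R \<aa> \<and> (\<forall>N. (\<aa>, N) \<in> hom_pairs_over R \<aa> \<longrightarrow> M \<subseteq> N)"
  unfolding least_def hom_poset_def hom_pairs_over_def by auto

lemma local_morphism_kernel_subset_jacobson:
  assumes "ring R" "ring S" "local_morphism R S \<phi>"
  shows "a_kernel R S \<phi> \<subseteq> jacobson_radical R"
proof
  interpret R: ring R by fact
  interpret S: ring S by fact
  have hom: "\<phi> \<in> ring_hom R S" using assms(3) by (simp add: local_morphism_def)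
  fix r assume "r \<in> a_kernel R S \<phi>"
  then have r: "r \<in> carrier R" "\<phi> r = \<zero>\<^bsub>S\<^esub>" by (auto simp: a_kernel_def')
  have "\<one>\<^bsub>R\<^esub> \<oplus>\<^bsub>R\<^esub> x \<otimes>\<^bsub>R\<^esub> r \<in> Units R" if x: "x \<in> carrier R" for x
  proof -
    have "\<phi> (\<one>\<^bsub>R\<^esub> \<oplus>\<^bsub>R\<^esub> x \<otimes>\<^bsub>R\<^esub> r) = \<one>\<^bsub>S\<^esub>"
      using r x ring_hom_closed[OF hom x]
      by (simp add: ring_hom_add[OF hom] ring_hom_mult[OF hom] ring_hom_one[OF hom])
    then show ?thesis using assms(3) r x by (simp add: local_morphism_def)
  qed
  then show "r \<in> jacobson_radical R" using r by (simp add: R.mem_jacobson_radical_iff)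
qed

theorem proposition7p6:
  fixes R :: "('a, 'm) ring_scheme" and S :: "('b, 'n) ring_scheme"
    and \<phi> :: "'a \<Rightarrow> 'b" and \<aa> M :: "'a set"
  assumes "nonzero_ring R" and "nonzero_ring S" and "\<phi> \<in> ring_hom R S"
    and "\<aa> = a_kernel R S \<phi>" and "M = unit_preimage R S \<phi>"
  shows "local_morphism R S \<phi> \<longleftrightarrow>
    \<aa> \<subseteq> jacobson_radical R \<and> least (hom_poset R) (\<aa>, M) (hom_pairs_over R \<aa>)"
proof
  interpret R: nonzero_ring R by fact
  interpret S: nonzero_ring S by fact
  interpret \<phi>: ring_hom_ring R S \<phi>
    by (rule ring_hom_ringI2[OF R.ring_axioms S.ring_axioms assms(3)])
  have pair: "(\<aa>, M) \<in> hom_pairs_over R \<aa>"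
    using hom_pairs_universal[OF assms(1-3)] assms(4,5) by (simp add: hom_pairs_over_def)
  {
    assume loc: "local_morphism R S \<phi>"
    then have "M \<subseteq> Units R"
      using assms(5) by (auto simp: unit_preimage_def local_morphism_def)
    then have "least (hom_poset R) (\<aa>, M) (hom_pairs_over R \<aa>)"
      unfolding least_hom_pairs_over_iff
      using pair Units_subset_hom_pairs_over[OF assms(1)] by (meson subset_trans)
    then show "\<aa> \<subseteq> jacobson_radical R \<and> least (hom_poset R) (\<aa>, M) (hom_pairs_over R \<aa>)"
      using local_morphism_kernel_subset_jacobson[OF R.ring_axioms S.ring_axioms loc]
        assms(4) by simp
  next
    assume *: "\<aa> \<subseteq> jacobson_radical R \<and>
      least (hom_poset R) (\<aa>, M) (hom_pairs_over R \<aa>)"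
    have id: "ideal \<aa> R" using \<phi>.kernel_is_ideal assms(4) by simp
    have "\<one>\<^bsub>R\<^esub> \<notin> \<aa>"
      unfolding assms(4) a_kernel_def' mem_Collect_eq ring_hom_one[OF assms(3)]
      using S.one_not_zero by blast
    then have "\<aa> \<noteq> carrier R" by auto
    then have sub: "M \<subseteq> unit_preimage R (R Quot \<aa>) ((+>\<^bsub>R\<^esub>) \<aa>)"
      using * quotient_pair_in_hom_pairs_over[OF assms(1) id]
      by (simp add: least_hom_pairs_over_iff)
    have "r \<in> Units R" if r: "r \<in> carrier R" "\<phi> r \<in> Units S" for r
    proof -
      have "r \<in> M" using r assms(5) by (simp add: unit_preimage_def)
      then have "\<aa> +>\<^bsub>R\<^esub> r \<in> Units (R Quot \<aa>)"
        using sub by (auto simp: unit_preimage_def)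
      then show ?thesis using R.Units_lift_mod_jacobson[OF id] * r(1) by simp
    qed
    then show "local_morphism R S \<phi>" using assms(3) by (simp add: local_morphism_def)
  }
qed

end
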